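(* Let $\phi=\phi(\mathfrak{Z})$ be the discrete determinantal process associated to a set $\mathfrak{Z}=\{z^{1},\dots,z^{p}\}$, $1<p<N$, of orthonormal vectors in $\mathbb{C}^{N}$. Let $2\leq n\leq p$ and let $x_{1},\dots,x_{n}\in\{1,\dots,N\}$ be distinct points such that $P\{\{x_{2},\dots,x_{n}\}\subset\phi^{c}\}>0$. Then $$\bigg|\langle z_{x_1},z_{x_n}\rangle+\sum_{k=1}^{n-2}(-1)^{k}\sum_{2\leq i_{1}<\dots<i_{k}\leq n-1}\Big\langle z_{x_1}\wedge\Big(\bigwedge_{j=1}^{k}z_{x_{i_{j}}}\Big),\ z_{x_n}\wedge\Big(\bigwedge_{j=1}^{k}z_{x_{i_{j}}}\Big)\Big\rangle\bigg|^{2}$$ $$=P\{\{x_{2},\dots,x_{n}\}\subset\phi^{c}\}\times P\{\{x_{2},\dots,x_{n-1}\}\subset\phi^{c}\}\times\Big[P\{x_{1}\in\phi\mid\{x_{2},\dots,x_{n}\}\subset\phi^{c}\}-P\{x_{1}\in\phi\mid\{x_{2},\dots,x_{n-1}\}\subset\phi^{c}\}\Big].$$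
   Context: Write $z^{i}=(z^{i}_{1},\dots,z^{i}_{N})^{t}$ for $i=1,\dots,p$ and $z_{i}=(z^{1}_{i},\dots,z^{p}_{i})\in\mathbb{C}^{p}$ for $i=1,\dots,N$. The process $\phi(\mathfrak{Z})$ is the random subset of $\{1,\dots,N\}$ of cardinality $p$ whose law is given by $P\{\phi=\{i_1,\dots,i_p\}\}=\left|\det\left((z^{k}_{i_j})_{k,j=1,\dots,p}\right)\right|^{2}$ for every $p$-element subset $\{i_1,\dots,i_p\}$. Here $\phi^{c}=\{1,\dots,N\}\setminus\phi$. The inner product on $\mathbb{C}^p$ is the standard Hermitian one, and on exterior powers of $\mathbb{C}^{p}$ it is the induced one: $\langle a_1\wedge\dots\wedge a_m,\ b_1\wedge\dots\wedge b_m\rangle=\det(\langle a_i,b_j\rangle)_{i,j=1,\dots,m}$. For $n=2$, the sum over $k$ is empty and $\{x_2,\dots,x_{n-1}\}=\emptyset$, so conditioning on $\{x_2,\dots,x_{n-1}\}\subset\phi^c$ is vacuous. *)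

theory Defs
  imports "HOL-Probability.Probability" "Jordan_Normal_Form.Determinant"
begin

unbundle no vec_syntax
hide_const (open) Determinants.det Finite_Cartesian_Product.vec

text \<open>
  Components of vectors are numbered from \<open>0\<close>, so \<open>{..<N}\<close> plays the role of \<open>{1, ..., N}\<close>
  and \<open>z 0, ..., z (p - 1)\<close> are the vectors \<open>z\<^sup>1, ..., z\<^sup>p\<close>. The inner product \<open>\<bullet>c\<close> is linear
  in its first and conjugate linear in its second argument.
\<close>

definition orthonormal_family :: "nat \<Rightarrow> nat \<Rightarrow> (nat \<Rightarrow> complex vec) \<Rightarrow> bool" where
  "orthonormal_family N p z \<longleftrightarrow>
     (\<forall>k<p. z k \<in> carrier_vec N) \<and>
     (\<forall>k<p. \<forall>l<p. z k \<bullet>c z l = (if k = l then 1 else 0))"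

text \<open>The vector \<open>z\<^sub>i = (z\<^sup>1\<^sub>i, ..., z\<^sup>p\<^sub>i)\<close>.\<close>

definition site_vec :: "nat \<Rightarrow> (nat \<Rightarrow> complex vec) \<Rightarrow> nat \<Rightarrow> complex vec" where
  "site_vec p z i = vec p (\<lambda>k. z k $ i)"

text \<open>
  \<open>wedge_inner as bs\<close> is the inner product of the decomposable multivectors
  \<open>a\<^sub>1 \<and> ... \<and> a\<^sub>m\<close> and \<open>b\<^sub>1 \<and> ... \<and> b\<^sub>m\<close>, which are given by the lists of their factors;
  it is meant for lists of equal length.
\<close>

definition wedge_inner :: "complex vec list \<Rightarrow> complex vec list \<Rightarrow> complex" where
  "wedge_inner as bs =
     det (mat (length as) (length as) (\<lambda>(i, j). (as ! i) \<bullet>c (bs ! j)))"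

definition determinantal_process ::
  "'a measure \<Rightarrow> nat \<Rightarrow> nat \<Rightarrow> (nat \<Rightarrow> complex vec) \<Rightarrow> ('a \<Rightarrow> nat set) \<Rightarrow> bool" where
  "determinantal_process M N p z \<phi> \<longleftrightarrow>
     prob_space M \<and>
     \<phi> \<in> measurable M (count_space {S. S \<subseteq> {..<N} \<and> card S = p}) \<and>
     (\<forall>S. S \<subseteq> {..<N} \<and> card S = p \<longrightarrow>
        \<P>(\<omega> in M. \<phi> \<omega> = S) =
        (cmod (det (mat p p (\<lambda>(k, j). z k $ (sorted_list_of_set S ! j)))))\<^sup>2)"

end

theory Submission
  imports Defs
begin

text \<open>
  Let \<open>K\<close> be the kernel with entries \<open>\<langle>z\<^sub>i, z\<^sub>j\<rangle>\<close> and let \<open>L = I - K\<close>. The set of sites that the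
  process misses is itself determinantal: the process avoids a set \<open>A\<close> with probability
  \<open>det L\<^sub>A\<close>, where \<open>L\<^sub>A\<close> is the restriction to \<open>A\<close> (\<open>prob_avoid_eq_set_det\<close>). This comes from the
  Cauchy--Binet formula and the identity \<open>det (1 - X Y) = det (1 - Y X)\<close>.

  Number the sites \<open>x\<^sub>1, ..., x\<^sub>n\<close> by their positions and put \<open>T = {2, ..., n - 1}\<close>. After
  multiplication by the two avoidance probabilities, the difference of conditional probabilities
  becomes the difference of products of minors
  \<open>det L\<^sub>1\<^sub>T \<cdot> det L\<^sub>T\<^sub>n - det L\<^sub>T \<cdot> det L\<^sub>1\<^sub>T\<^sub>n\<close>. By the Desnanot--Jacobi identity this is the product
  of the minor \<open>D\<close> of \<open>L\<close> with rows \<open>1, T\<close> and columns \<open>n, T\<close> and the minor with rows and columns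
  interchanged. As \<open>L\<close> is Hermitian, the product is \<open>|D|\<^sup>2\<close>. The identity is obtained by eliminating
  the block \<open>L\<^sub>T\<close>; it is invertible because avoiding \<open>T\<close> has positive probability.

  It remains to see that the bracket on the left is \<open>- D\<close>. The matrix of \<open>D\<close> is the negative of
  the corresponding matrix of inner products plus the identity on \<open>T\<close>; there is no diagonal
  contribution at \<open>(1, n)\<close> because \<open>x\<^sub>1 \<noteq> x\<^sub>n\<close>. Expanding along this diagonal
  (\<open>set_det_bordered_one_minus\<close>) gives one minor with border \<open>(1, n)\<close> for every subset of \<open>T\<close>,
  signed by the size of the subset, and each of these minors is an inner product of wedge products.
\<close>

section \<open>Determinants indexed by finite sets\<close>

text \<open>
  The Leibniz determinant of an array indexed by a finite set. Rows and columns share the index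
  set, so no order has to be chosen and principal minors are obtained by shrinking the set. A
  minor with different rows and columns is obtained by renaming one index in the array.
\<close>

definition set_det :: "'i set \<Rightarrow> ('i \<Rightarrow> 'i \<Rightarrow> 'a :: comm_ring_1) \<Rightarrow> 'a" where
  "set_det S M = (\<Sum>\<sigma> | \<sigma> permutes S. of_int (sign \<sigma>) * (\<Prod>i\<in>S. M i (\<sigma> i)))"

lemma set_det_cong:
  assumes "\<And>i j. i \<in> S \<Longrightarrow> j \<in> S \<Longrightarrow> M i j = M' i j"
  shows "set_det S M = set_det S M'"
  unfolding set_det_def
  by (intro sum.cong refl arg_cong2[where f = "(*)"] prod.cong)
     (auto simp: assms permutes_in_image)

lemma set_det_reindex:
  fixes M :: "'j \<Rightarrow> 'j \<Rightarrow> 'a :: comm_ring_1"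
  assumes f: "bij_betw f A B" and "finite A"
  shows "set_det B M = set_det A (\<lambda>i j. M (f i) (f j))"
proof -
  have inj: "inj_on f A" and B: "B = f ` A"
    using f by (auto simp: bij_betw_def)
  have "map_permutation A f = (\<lambda>\<sigma> i. if i \<in> B then f (\<sigma> (inv_into A f i)) else i)"
    by (auto simp: fun_eq_iff map_permutation_def restrict_id_def B)
  with bij_betw_permutations[OF f]
  have bij: "bij_betw (map_permutation A f) {\<sigma>. \<sigma> permutes A} {\<sigma>. \<sigma> permutes B}"
    by simp
  have "set_det B M = (\<Sum>\<sigma> | \<sigma> permutes A. of_int (sign (map_permutation A f \<sigma>)) *
      (\<Prod>i\<in>B. M i (map_permutation A f \<sigma> i)))"
    unfolding set_det_def by (rule sum.reindex_bij_betw[OF bij, symmetric])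
  also have "\<dots> = set_det A (\<lambda>i j. M (f i) (f j))"
    unfolding set_det_def
  proof (intro sum.cong refl arg_cong2[where f = "(*)"])
    fix \<sigma> assume "\<sigma> \<in> {\<sigma>. \<sigma> permutes A}"
    then have \<sigma>: "\<sigma> permutes A" by simp
    show "of_int (sign (map_permutation A f \<sigma>)) = (of_int (sign \<sigma>) :: 'a)"
      by (simp add: sign_map_permutation inj \<sigma> assms)
    show "(\<Prod>i\<in>B. M i (map_permutation A f \<sigma> i)) = (\<Prod>i\<in>A. M (f i) (f (\<sigma> i)))"
      unfolding B using inj by (simp add: prod.reindex map_permutation_apply)
  qed
  finally show ?thesis .
qed

lemma det_mat_eq_set_det:
  assumes "distinct xs"
  shows "det (mat (length xs) (length xs) (\<lambda>(i, j). M (xs ! i) (xs ! j))) = set_det (set xs) M"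
proof -
  have "set_det (set xs) M = set_det {0..<length xs} (\<lambda>i j. M (xs ! i) (xs ! j))"
    by (rule set_det_reindex) (use assms in \<open>auto intro!: bij_betw_nth simp: lessThan_atLeast0\<close>)
  also have "\<dots> = det (mat (length xs) (length xs) (\<lambda>(i, j). M (xs ! i) (xs ! j)))"
    unfolding set_det_def det_def by (auto intro!: sum.cong prod.cong simp: permutes_in_image)
  finally show ?thesis ..
qed

lemma set_det_transpose:
  assumes "finite S"
  shows "set_det S (\<lambda>i j. M j i) = set_det S M"
proof -
  obtain xs where xs: "distinct xs" "set xs = S"
    using finite_distinct_list[OF assms] by blast
  let ?n = "length xs"
  have "transpose_mat (mat ?n ?n (\<lambda>(i, j). M (xs ! i) (xs ! j))) =
      mat ?n ?n (\<lambda>(i, j). M (xs ! j) (xs ! i))"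
    by (intro eq_matI) auto
  then show ?thesis
    using det_mat_eq_set_det[OF xs(1), of M] det_mat_eq_set_det[OF xs(1), of "\<lambda>i j. M j i"]
      det_transpose[of "mat ?n ?n (\<lambda>(i, j). M (xs ! i) (xs ! j))" ?n]
    by (simp add: xs)
qed

lemma set_det_cnj: "set_det S (\<lambda>i j. cnj (M i j)) = cnj (set_det S M)"
  by (simp add: set_det_def)

lemma set_det_uminus: "set_det S (\<lambda>i j. - M i j) = (- 1) ^ card S * set_det S M"
  by (simp add: set_det_def prod_uminus sum_distrib_left mult_ac)

text \<open>
  In the product over the rows, choose for each row either the diagonal term or the entry of
  \<open>M\<close>. If \<open>I\<close> is the set of rows in which \<open>M\<close> is chosen, only the permutations that fix every
  index outside \<open>I\<close> contribute, and these are the permutations of \<open>I\<close>.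
\<close>

lemma set_det_diagonal_add:
  assumes S: "finite S"
  shows "set_det S (\<lambda>i j. (if i = j then d i else 0) + M i j) =
    (\<Sum>I\<in>Pow S. (\<Prod>i\<in>S - I. d i) * set_det I M)"
proof -
  let ?D = "\<lambda>i j. if i = j then d i else 0"
  have "set_det S (\<lambda>i j. ?D i j + M i j) =
      (\<Sum>\<sigma> | \<sigma> permutes S. \<Sum>I\<in>Pow S.
        of_int (sign \<sigma>) * ((\<Prod>i\<in>I. M i (\<sigma> i)) * (\<Prod>i\<in>S - I. ?D i (\<sigma> i))))"
    unfolding set_det_def by (simp add: add.commute[of "?D _ _"] prod_add S sum_distrib_left)
  also have "\<dots> = (\<Sum>I\<in>Pow S. \<Sum>\<sigma> | \<sigma> permutes S.
        of_int (sign \<sigma>) * ((\<Prod>i\<in>I. M i (\<sigma> i)) * (\<Prod>i\<in>S - I. ?D i (\<sigma> i))))"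
    by (rule sum.swap)
  also have "\<dots> = (\<Sum>I\<in>Pow S. (\<Prod>i\<in>S - I. d i) * set_det I M)"
  proof (rule sum.cong[OF refl])
    fix I assume "I \<in> Pow S"
    then have I: "I \<subseteq> S" by simp
    have "(\<Sum>\<sigma> | \<sigma> permutes S.
        of_int (sign \<sigma>) * ((\<Prod>i\<in>I. M i (\<sigma> i)) * (\<Prod>i\<in>S - I. ?D i (\<sigma> i)))) =
      (\<Sum>\<sigma> | \<sigma> permutes I.
        of_int (sign \<sigma>) * ((\<Prod>i\<in>I. M i (\<sigma> i)) * (\<Prod>i\<in>S - I. ?D i (\<sigma> i))))"
    proof (rule sum.mono_neutral_right)
      show "finite {\<sigma>. \<sigma> permutes S}" by (rule finite_permutations[OF S])
      show "{\<sigma>. \<sigma> permutes I} \<subseteq> {\<sigma>. \<sigma> permutes S}"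
        using I by (auto intro: permutes_subset)
      show "\<forall>\<sigma>\<in>{\<sigma>. \<sigma> permutes S} - {\<sigma>. \<sigma> permutes I}.
        of_int (sign \<sigma>) * ((\<Prod>i\<in>I. M i (\<sigma> i)) * (\<Prod>i\<in>S - I. ?D i (\<sigma> i))) = 0"
      proof
        fix \<sigma> assume \<sigma>: "\<sigma> \<in> {\<sigma>. \<sigma> permutes S} - {\<sigma>. \<sigma> permutes I}"
        then obtain i where "i \<in> S - I" "\<sigma> i \<noteq> i"
          using permutes_superset[of \<sigma> S I] by auto
        then have "(\<Prod>i\<in>S - I. ?D i (\<sigma> i)) = 0"
          using S by (intro prod_zero) (auto intro!: bexI[of _ i])
        then show "of_int (sign \<sigma>) *
            ((\<Prod>i\<in>I. M i (\<sigma> i)) * (\<Prod>i\<in>S - I. ?D i (\<sigma> i))) = 0" by simp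
      qed
    qed
    also have "\<dots> = (\<Sum>\<sigma> | \<sigma> permutes I.
        (\<Prod>i\<in>S - I. d i) * (of_int (sign \<sigma>) * (\<Prod>i\<in>I. M i (\<sigma> i))))"
    proof (rule sum.cong[OF refl])
      fix \<sigma> assume "\<sigma> \<in> {\<sigma>. \<sigma> permutes I}"
      then have "(\<Prod>i\<in>S - I. ?D i (\<sigma> i)) = (\<Prod>i\<in>S - I. d i)"
        by (intro prod.cong) (auto simp: permutes_not_in)
      then show "of_int (sign \<sigma>) * ((\<Prod>i\<in>I. M i (\<sigma> i)) * (\<Prod>i\<in>S - I. ?D i (\<sigma> i))) =
        (\<Prod>i\<in>S - I. d i) * (of_int (sign \<sigma>) * (\<Prod>i\<in>I. M i (\<sigma> i)))"
        by (simp add: mult_ac)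
    qed
    finally show "(\<Sum>\<sigma> | \<sigma> permutes S.
        of_int (sign \<sigma>) * ((\<Prod>i\<in>I. M i (\<sigma> i)) * (\<Prod>i\<in>S - I. ?D i (\<sigma> i)))) =
        (\<Prod>i\<in>S - I. d i) * set_det I M"
      by (simp add: set_det_def sum_distrib_left)
  qed
  finally show ?thesis .
qed

text \<open>
  The bracket of the theorem is an alternating sum of this shape; the lemma collapses it into a
  single determinant. The row \<open>a\<close> has no diagonal term, so it belongs to every index set that
  contributes to the diagonal expansion; this is why each summand has the border \<open>a\<close>.
\<close>

lemma set_det_bordered_one_minus:
  fixes K :: "'i \<Rightarrow> 'i \<Rightarrow> 'a :: comm_ring_1"
  assumes T: "finite T" "a \<notin> T"
  shows "set_det (insert a T) (\<lambda>i j. (if i = j \<and> i \<noteq> a then 1 else 0) - K i j) =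
    - (\<Sum>k\<le>card T. (- 1) ^ k * (\<Sum>I | I \<subseteq> T \<and> card I = k. set_det (insert a I) K))"
proof -
  let ?S = "insert a T"
  let ?d = "\<lambda>i. if i = a then 0 else (1 :: 'a)"
  let ?g = "\<lambda>I. (\<Prod>i\<in>?S - I. ?d i) * set_det I (\<lambda>i j. - K i j)"
  have "set_det ?S (\<lambda>i j. (if i = j \<and> i \<noteq> a then 1 else 0) - K i j) =
      set_det ?S (\<lambda>i j. (if i = j then ?d i else 0) + - K i j)"
    by (rule set_det_cong) auto
  also have "\<dots> = sum ?g (Pow ?S)"
    by (rule set_det_diagonal_add) (use T in auto)
  also have "\<dots> = sum ?g (insert a ` Pow T)"
  proof (rule sum.mono_neutral_right)
    show "\<forall>I\<in>Pow ?S - insert a ` Pow T. ?g I = 0"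
    proof
      fix I assume I: "I \<in> Pow ?S - insert a ` Pow T"
      have "a \<notin> I"
      proof
        assume "a \<in> I"
        then have "I = insert a (I - {a})" "I - {a} \<in> Pow T" using I by auto
        then show False using I by blast
      qed
      then have "(\<Prod>i\<in>?S - I. ?d i) = 0"
        using T by (intro prod_zero) auto
      then show "?g I = 0" by simp
    qed
  qed (use T in auto)
  also have "\<dots> = (\<Sum>I\<in>Pow T. ?g (insert a I))"
    by (rule sum.reindex[unfolded o_def]) (use T in \<open>auto simp: inj_on_def\<close>)
  also have "\<dots> = (\<Sum>I\<in>Pow T. - ((- 1) ^ card I * set_det (insert a I) K))"
  proof (rule sum.cong[OF refl])
    fix I assume "I \<in> Pow T"
    then have "a \<notin> I" "finite I" using T by (auto intro: finite_subset)
    moreover have "(\<Prod>i\<in>?S - insert a I. ?d i) = 1"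
      by (intro prod.neutral) auto
    ultimately show "?g (insert a I) = - ((- 1) ^ card I * set_det (insert a I) K)"
      by (simp add: set_det_uminus)
  qed
  also have "\<dots> = - (\<Sum>I\<in>Pow T. (- 1) ^ card I * set_det (insert a I) K)"
    by (simp add: sum_negf)
  also have "(\<Sum>I\<in>Pow T. (- 1) ^ card I * set_det (insert a I) K) =
      (\<Sum>k\<le>card T. \<Sum>I\<in>{I \<in> Pow T. card I = k}. (- 1) ^ card I * set_det (insert a I) K)"
    by (rule sum.group[symmetric]) (use T in \<open>auto intro: card_mono\<close>)
  also have "\<dots> = (\<Sum>k\<le>card T. (- 1) ^ k * (\<Sum>I | I \<subseteq> T \<and> card I = k. set_det (insert a I) K))"
    by (simp add: sum_distrib_left)
  finally show ?thesis .
qed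

section \<open>The Cauchy--Binet formula\<close>

text \<open>
  Expanding the product of the \<open>p\<close> inner sums gives one term for each choice function
  \<open>f\<close> of the summation indices, namely a product of entries of \<open>a\<close> times the determinant of
  the rows of \<open>b\<close> selected by \<open>f\<close>. A choice that repeats an index selects two equal rows and
  contributes nothing. An injective choice with image \<open>S\<close> is a permutation of the increasing
  enumeration of \<open>S\<close>, and the sum over these permutations is the Leibniz formula for the minor
  of \<open>a\<close>.
\<close>

lemma Cauchy_Binet:
  fixes a :: "nat \<Rightarrow> 'i :: linorder \<Rightarrow> 'a :: comm_ring_1" and b :: "'i \<Rightarrow> nat \<Rightarrow> 'a"
  assumes \<Omega>: "finite \<Omega>"
  shows "det (mat p p (\<lambda>(k, l). \<Sum>i\<in>\<Omega>. a k i * b i l)) =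
    (\<Sum>S | S \<subseteq> \<Omega> \<and> card S = p.
       det (mat p p (\<lambda>(k, j). a k (sorted_list_of_set S ! j))) *
       det (mat p p (\<lambda>(j, l). b (sorted_list_of_set S ! j) l)))"
proof -
  let ?U = "{0..<p}"
  let ?e = "\<lambda>S. (!) (sorted_list_of_set S)"
  define R where "R f = mat p p (\<lambda>(k, l). b (f k) l)" for f
  define t where "t f = (\<Prod>k\<in>?U. a k (f k)) * det (R f)" for f
  have R: "R f \<in> carrier_mat p p" for f
    by (simp add: R_def)
  have R_cong: "R f = R g" if "\<And>k. k < p \<Longrightarrow> f k = g k" for f g
    using that by (auto simp: R_def intro!: eq_matI)
  have "det (mat p p (\<lambda>(k, l). \<Sum>i\<in>\<Omega>. a k i * b i l)) =
      (\<Sum>\<sigma> | \<sigma> permutes ?U. of_int (sign \<sigma>) * (\<Prod>k\<in>?U. \<Sum>i\<in>\<Omega>. a k i * b i (\<sigma> k)))"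
    by (auto simp: det_def permutes_in_image intro!: sum.cong prod.cong)
  also have "\<dots> = (\<Sum>\<sigma> | \<sigma> permutes ?U. \<Sum>f\<in>?U \<rightarrow>\<^sub>E \<Omega>.
      (\<Prod>k\<in>?U. a k (f k)) * (of_int (sign \<sigma>) * (\<Prod>k\<in>?U. b (f k) (\<sigma> k))))"
    by (subst prod_sum_PiE) (auto simp: \<Omega> sum_distrib_left prod.distrib mult_ac)
  also have "\<dots> = (\<Sum>f\<in>?U \<rightarrow>\<^sub>E \<Omega>. \<Sum>\<sigma> | \<sigma> permutes ?U.
      (\<Prod>k\<in>?U. a k (f k)) * (of_int (sign \<sigma>) * (\<Prod>k\<in>?U. b (f k) (\<sigma> k))))"
    by (rule sum.swap)
  also have "\<dots> = (\<Sum>f\<in>?U \<rightarrow>\<^sub>E \<Omega>. t f)"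
    unfolding t_def R_def det_def'[OF mat_carrier] sum_distrib_left
    by (auto simp: permutes_in_image intro!: sum.cong prod.cong)
  also have "\<dots> = (\<Sum>f | f \<in> ?U \<rightarrow>\<^sub>E \<Omega> \<and> inj_on f ?U. t f)"
  proof (rule sum.mono_neutral_right)
    show "finite (?U \<rightarrow>\<^sub>E \<Omega>)" using \<Omega> by (intro finite_PiE) auto
    show "\<forall>f\<in>(?U \<rightarrow>\<^sub>E \<Omega>) - {f. f \<in> ?U \<rightarrow>\<^sub>E \<Omega> \<and> inj_on f ?U}. t f = 0"
    proof
      fix f assume "f \<in> (?U \<rightarrow>\<^sub>E \<Omega>) - {f. f \<in> ?U \<rightarrow>\<^sub>E \<Omega> \<and> inj_on f ?U}"
      then obtain k l where kl: "k < p" "l < p" "k \<noteq> l" "f k = f l"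
        by (auto simp: inj_on_def)
      then have "det (R f) = 0"
        by (intro det_identical_rows[OF R, of k l]) (auto simp: R_def row_def)
      then show "t f = 0" by (simp add: t_def)
    qed
  qed auto
  also have "\<dots> = (\<Sum>S | S \<subseteq> \<Omega> \<and> card S = p.
      sum t {f. f \<in> ?U \<rightarrow>\<^sub>E \<Omega> \<and> inj_on f ?U \<and> f ` ?U = S})"
  proof -
    have "(\<Sum>S | S \<subseteq> \<Omega> \<and> card S = p.
        sum t {f \<in> {f. f \<in> ?U \<rightarrow>\<^sub>E \<Omega> \<and> inj_on f ?U}. f ` ?U = S}) =
        (\<Sum>f | f \<in> ?U \<rightarrow>\<^sub>E \<Omega> \<and> inj_on f ?U. t f)"
    proof (rule sum.group)
      have "finite (?U \<rightarrow>\<^sub>E \<Omega>)" using \<Omega> by (intro finite_PiE) auto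
      then show "finite {f. f \<in> ?U \<rightarrow>\<^sub>E \<Omega> \<and> inj_on f ?U}"
        by (rule rev_finite_subset) auto
      show "finite {S. S \<subseteq> \<Omega> \<and> card S = p}" using \<Omega> by auto
      show "(\<lambda>f. f ` ?U) ` {f. f \<in> ?U \<rightarrow>\<^sub>E \<Omega> \<and> inj_on f ?U} \<subseteq> {S. S \<subseteq> \<Omega> \<and> card S = p}"
        by (auto simp: card_image)
    qed
    then show ?thesis by (simp add: conj_assoc)
  qed
  also have "\<dots> = (\<Sum>S | S \<subseteq> \<Omega> \<and> card S = p.
       det (mat p p (\<lambda>(k, j). a k (?e S j))) * det (R (?e S)))"
  proof (rule sum.cong[OF refl])
    fix S assume "S \<in> {S. S \<subseteq> \<Omega> \<and> card S = p}"
    then have S: "S \<subseteq> \<Omega>" "card S = p" "finite S"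
      using \<Omega> finite_subset by auto
    have e: "bij_betw (?e S) ?U S"
      using S by (auto intro!: bij_betw_nth simp: lessThan_atLeast0)
    \<comment> \<open>an injective choice \<open>f\<close> with image \<open>S\<close> corresponds to the permutation \<open>e\<^sup>-\<^sup>1 \<circ> f\<close>, where \<open>e\<close>
      enumerates \<open>S\<close> increasingly\<close>
    have "sum t {f. f \<in> ?U \<rightarrow>\<^sub>E \<Omega> \<and> inj_on f ?U \<and> f ` ?U = S} =
        (\<Sum>\<sigma> | \<sigma> permutes ?U. t (\<lambda>k. ?e S (\<sigma> k)))"
    proof (rule sym, rule sum.reindex_bij_witness)
      fix \<sigma> assume "\<sigma> \<in> {\<sigma>. \<sigma> permutes ?U}"
      then have \<sigma>: "\<sigma> permutes ?U" by simp
      let ?f = "restrict (\<lambda>k. ?e S (\<sigma> k)) ?U"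
      have b: "bij_betw ?f ?U S"
        using bij_betw_trans[OF permutes_imp_bij[OF \<sigma>] e]
        by (subst bij_betw_cong[where g = "?e S \<circ> \<sigma>"]) auto
      then show "?f \<in> {f. f \<in> ?U \<rightarrow>\<^sub>E \<Omega> \<and> inj_on f ?U \<and> f ` ?U = S}"
        using S(1) by (auto simp: bij_betw_def restrict_def)
      show "(\<lambda>k. if k \<in> ?U then inv_into ?U (?e S) (?f k) else k) = \<sigma>"
        using \<sigma> e by (auto simp: fun_eq_iff permutes_not_in permutes_in_image bij_betw_inv_into_left)
      show "t ?f = t (\<lambda>k. ?e S (\<sigma> k))"
        unfolding t_def by (intro arg_cong2[where f = "(*)"] prod.cong arg_cong[where f = det] R_cong) auto
    next
      fix f assume "f \<in> {f. f \<in> ?U \<rightarrow>\<^sub>E \<Omega> \<and> inj_on f ?U \<and> f ` ?U = S}"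
      then have f: "f \<in> ?U \<rightarrow>\<^sub>E \<Omega>" "bij_betw f ?U S" by (auto simp: bij_betw_def)
      let ?\<sigma> = "\<lambda>k. if k \<in> ?U then inv_into ?U (?e S) (f k) else k"
      have "bij_betw ?\<sigma> ?U ?U"
        using bij_betw_trans[OF f(2) bij_betw_inv_into[OF e]]
        by (subst bij_betw_cong[where g = "inv_into ?U (?e S) \<circ> f"]) auto
      then have \<sigma>: "?\<sigma> permutes ?U" by (rule bij_imp_permutes) auto
      then show "?\<sigma> \<in> {\<sigma>. \<sigma> permutes ?U}" by simp
      show "restrict (\<lambda>k. ?e S (?\<sigma> k)) ?U = f"
      proof
        fix k
        show "restrict (\<lambda>k. ?e S (?\<sigma> k)) ?U k = f k"
        proof (cases "k \<in> ?U")
          case True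
          then have "f k \<in> S" using f(2) by (rule bij_betw_apply[rotated])
          then show ?thesis using True by (simp add: bij_betw_inv_into_right[OF e])
        next
          case False
          then show ?thesis using PiE_arb[OF f(1)] by simp
        qed
      qed
    qed
    also have "\<dots> = (\<Sum>\<sigma> | \<sigma> permutes ?U.
        of_int (sign \<sigma>) * (\<Prod>k\<in>?U. a k (?e S (\<sigma> k))) * det (R (?e S)))"
    proof (rule sum.cong[OF refl])
      fix \<sigma> assume "\<sigma> \<in> {\<sigma>. \<sigma> permutes ?U}"
      then have \<sigma>: "\<sigma> permutes ?U" by simp
      have "R (\<lambda>k. ?e S (\<sigma> k)) = mat p p (\<lambda>(i, j). R (?e S) $$ (\<sigma> i, j))"
        by (rule eq_matI) (use permutes_in_image[OF \<sigma>] in \<open>simp_all add: R_def\<close>)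
      then have "det (R (\<lambda>k. ?e S (\<sigma> k))) = of_int (sign \<sigma>) * det (R (?e S))"
        using det_permute_rows[OF R \<sigma>] by simp
      then show "t (\<lambda>k. ?e S (\<sigma> k)) =
          of_int (sign \<sigma>) * (\<Prod>k\<in>?U. a k (?e S (\<sigma> k))) * det (R (?e S))"
        by (simp add: t_def mult_ac)
    qed
    also have "\<dots> = det (mat p p (\<lambda>(k, j). a k (?e S j))) * det (R (?e S))"
      unfolding det_def'[OF mat_carrier] sum_distrib_right
      by (auto simp: permutes_in_image intro!: sum.cong prod.cong)
    finally show "sum t {f. f \<in> ?U \<rightarrow>\<^sub>E \<Omega> \<and> inj_on f ?U \<and> f ` ?U = S} =
        det (mat p p (\<lambda>(k, j). a k (?e S j))) * det (R (?e S))" .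
  qed
  finally show ?thesis by (simp add: R_def)
qed

section \<open>Block elimination and the Desnanot--Jacobi identity\<close>

text \<open>
  Both sides are the determinant of the block matrix with rows \<open>(1, X)\<close> and \<open>(Y, 1)\<close>, as
  eliminating either off-diagonal block shows.
\<close>

lemma det_one_minus_mult_commute:
  fixes X Y :: "'a :: idom mat"
  assumes X: "X \<in> carrier_mat m n" and Y: "Y \<in> carrier_mat n m"
  shows "det (1\<^sub>m m - X * Y) = det (1\<^sub>m n - Y * X)"
proof -
  have XY: "1\<^sub>m m - X * Y \<in> carrier_mat m m" and YX: "1\<^sub>m n - Y * X \<in> carrier_mat n n"
    using X Y by auto
  let ?B = "four_block_mat (1\<^sub>m m) X Y (1\<^sub>m n)"
  have "?B = four_block_mat (1\<^sub>m m) X (0\<^sub>m n m) (1\<^sub>m n) *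
      four_block_mat (1\<^sub>m m - X * Y) (0\<^sub>m m n) Y (1\<^sub>m n)"
    using X Y by (subst mult_four_block_mat[where ?nr1.0 = m and ?n1.0 = m and ?n2.0 = n and ?nr2.0 = n])
      (auto intro!: cong_four_block_mat eq_matI)
  also have "det \<dots> = det (1\<^sub>m m - X * Y)"
    using X Y XY YX by (subst det_mult[of _ "m + n"])
      (auto simp: det_four_block_mat_lower_left_zero[OF _ _ refl]
        det_four_block_mat_upper_right_zero[OF _ refl])
  finally have 1: "det ?B = det (1\<^sub>m m - X * Y)" .
  have "?B = four_block_mat (1\<^sub>m m) (0\<^sub>m m n) Y (1\<^sub>m n) *
      four_block_mat (1\<^sub>m m) X (0\<^sub>m n m) (1\<^sub>m n - Y * X)"
    using X Y by (subst mult_four_block_mat[where ?nr1.0 = m and ?n1.0 = m and ?n2.0 = n and ?nr2.0 = n])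
      (auto intro!: cong_four_block_mat eq_matI)
  also have "det \<dots> = det (1\<^sub>m n - Y * X)"
    using X Y XY YX by (subst det_mult[of _ "m + n"])
      (auto simp: det_four_block_mat_lower_left_zero[OF _ _ refl]
        det_four_block_mat_upper_right_zero[OF _ refl])
  finally show ?thesis using 1 by simp
qed

lemma det_four_block_mat_Schur:
  fixes A :: "'a :: idom mat"
  assumes A: "A \<in> carrier_mat m m" and B: "B \<in> carrier_mat m n"
    and C: "C \<in> carrier_mat n m" and D: "D \<in> carrier_mat n n"
    and A': "A' \<in> carrier_mat m m" and inv: "A' * A = 1\<^sub>m m"
  shows "det (four_block_mat A B C D) = det A * det (D - C * A' * B)"
proof -
  have "C * A' * A = C"
    using A A' C inv by (simp add: assoc_mult_mat[of _ n m _ m _ m])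
  then have "four_block_mat A B C D =
      four_block_mat (1\<^sub>m m) (0\<^sub>m m n) (C * A') (1\<^sub>m n) *
      four_block_mat A B (0\<^sub>m n m) (D - C * A' * B)"
    using A B C D A'
    by (subst mult_four_block_mat[where ?nr1.0 = m and ?n1.0 = m and ?n2.0 = n and ?nr2.0 = n])
      (auto intro!: cong_four_block_mat eq_matI)
  also have "det \<dots> = det A * det (D - C * A' * B)"
  proof -
    have S: "D - C * A' * B \<in> carrier_mat n n" and CA': "C * A' \<in> carrier_mat n m"
      using A B C D A' by auto
    show ?thesis
      by (subst det_mult[of _ "m + n"])
        (use A B S CA' in \<open>auto simp: det_four_block_mat_lower_left_zero[OF A B refl S]
          det_four_block_mat_upper_right_zero[OF one_carrier_mat refl CA' one_carrier_mat]\<close>)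
  qed
  finally show ?thesis .
qed

lemma det_mat_1: "det (mat 1 1 f) = f (0, 0)"
  by (simp add: det_single)

lemma det_mat_2:
  "det (mat 2 2 f) = f (0, 0) * f (1, 1) - f (0, 1) * f (1, 0)" for f :: "_ \<Rightarrow> 'a :: idom"
proof -
  have "mat 2 2 f = four_block_mat (mat 1 1 (\<lambda>_. f (0, 0))) (mat 1 1 (\<lambda>_. f (0, 1)))
      (mat 1 1 (\<lambda>_. f (1, 0))) (mat 1 1 (\<lambda>_. f (1, 1)))"
    by (intro eq_matI) (auto simp: less_Suc_eq numeral_2_eq_2)
  also have "det \<dots> = f (0, 0) * f (1, 1) - f (0, 1) * f (1, 0)"
  proof -
    have "mat 1 1 (\<lambda>_. f (0, 0)) * mat 1 1 (\<lambda>_. f (1, 1)) -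
        mat 1 1 (\<lambda>_. f (0, 1)) * mat 1 1 (\<lambda>_. f (1, 0)) =
        mat 1 1 (\<lambda>_. f (0, 0) * f (1, 1) - f (0, 1) * f (1, 0))"
      by (rule eq_matI) (auto simp: scalar_prod_def)
    then show ?thesis
      by (subst det_four_block_mat[of _ 1])
         (auto intro!: eq_matI simp: scalar_prod_def mult.commute det_mat_1[simplified])
  qed
  finally show ?thesis .
qed

text \<open>
  Eliminating the rows of the invertible block on \<open>T\<close> turns every bordered minor into the minor on
  \<open>T\<close> times a determinant formed from the Schur complement \<open>s\<close>. The identity becomes the expansion
  of the \<open>2 \<times> 2\<close> determinant of \<open>s\<close> on \<open>{a, b}\<close>. The two factors on the right are the minors
  that omit row \<open>b\<close> and column \<open>a\<close>, and row \<open>a\<close> and column \<open>b\<close>; the replacement of a single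
  index lets both live on \<open>insert a T\<close>.
\<close>

lemma Desnanot_Jacobi:
  fixes M :: "'i \<Rightarrow> 'i \<Rightarrow> 'a :: field"
  assumes T: "finite T" and ab: "a \<notin> T" "b \<notin> T" "a \<noteq> b" and nz: "set_det T M \<noteq> 0"
  shows "set_det (insert a T) M * set_det (insert b T) M -
      set_det T M * set_det (insert a (insert b T)) M =
      set_det (insert a T) (\<lambda>i j. M i (if j = a then b else j)) *
      set_det (insert a T) (\<lambda>i j. M (if i = a then b else i) j)"
proof -
  obtain xs where xs: "distinct xs" "set xs = T"
    using finite_distinct_list[OF T] by blast
  let ?m = "length xs"
  define A where "A = mat ?m ?m (\<lambda>(i, j). M (xs ! i) (xs ! j))"
  have A: "A \<in> carrier_mat ?m ?m" by (simp add: A_def)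
  have detA: "det A = set_det T M"
    using det_mat_eq_set_det[OF xs(1), of M] by (simp add: A_def xs)
  obtain A' where A': "A' \<in> carrier_mat ?m ?m" "A' * A = 1\<^sub>m ?m"
    using det_non_zero_imp_unit[OF A] nz detA
    by (auto simp: Units_def ring_mat_def)
  define R where "R rs = mat (length rs) ?m (\<lambda>(i, j). M (rs ! i) (xs ! j))" for rs
  define C where "C cs = mat ?m (length cs) (\<lambda>(i, j). M (xs ! i) (cs ! j))" for cs
  \<comment> \<open>the Schur complement of the block on \<open>T\<close>, for an arbitrary row \<open>u\<close> and column \<open>v\<close>\<close>
  define s where "s u v = M u v -
      (\<Sum>l<?m. (\<Sum>k<?m. M u (xs ! k) * A' $$ (k, l)) * M (xs ! l) v)" for u v
  have Schur: "det (mat (?m + k) (?m + k) (\<lambda>(i, j). M ((xs @ rs) ! i) ((xs @ cs) ! j))) =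
      set_det T M * det (mat k k (\<lambda>(i, j). s (rs ! i) (cs ! j)))"
    if k: "length rs = k" "length cs = k" for k rs cs
  proof -
    let ?D = "mat k k (\<lambda>(i, j). M (rs ! i) (cs ! j))"
    have R: "R rs \<in> carrier_mat k ?m" and C: "C cs \<in> carrier_mat ?m k"
      by (auto simp: R_def C_def k)
    have "mat (?m + k) (?m + k) (\<lambda>(i, j). M ((xs @ rs) ! i) ((xs @ cs) ! j)) =
        four_block_mat A (C cs) (R rs) ?D"
      by (intro eq_matI) (auto simp: A_def C_def R_def k nth_append)
    also have "det \<dots> = det A * det (?D - R rs * A' * C cs)"
      by (rule det_four_block_mat_Schur[OF A C R _ A']) auto
    also have "?D - R rs * A' * C cs = mat k k (\<lambda>(i, j). s (rs ! i) (cs ! j))"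
    proof (intro eq_matI)
      fix i j assume "i < dim_row (mat k k (\<lambda>(i, j). s (rs ! i) (cs ! j)))"
        "j < dim_col (mat k k (\<lambda>(i, j). s (rs ! i) (cs ! j)))"
      then have ij: "i < k" "j < k" by auto
      have "(R rs * A' * C cs) $$ (i, j) =
          (\<Sum>l<?m. (\<Sum>k<?m. M (rs ! i) (xs ! k) * A' $$ (k, l)) * M (xs ! l) (cs ! j))"
        using ij k A'(1) by (auto simp: R_def C_def scalar_prod_def lessThan_atLeast0 intro!: sum.cong)
      then show "(?D - R rs * A' * C cs) $$ (i, j) = mat k k (\<lambda>(i, j). s (rs ! i) (cs ! j)) $$ (i, j)"
        using ij R C A' by (simp add: s_def)
    qed (use R C A' in auto)
    finally show ?thesis by (simp add: detA)
  qed
  have border: "set_det (insert c T) (\<lambda>i j. M (if i = c then u else i) (if j = c then v else j)) =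
      set_det T M * s u v" if "c \<notin> T" for c u v
  proof -
    have "set_det (insert c T) (\<lambda>i j. M (if i = c then u else i) (if j = c then v else j)) =
        det (mat (?m + 1) (?m + 1) (\<lambda>(i, j). M ((xs @ [u]) ! i) ((xs @ [v]) ! j)))"
    proof -
      have "xs ! i \<noteq> c" if "i < ?m" for i
        using that xs(2) \<open>c \<notin> T\<close> nth_mem by blast
      then have "mat (?m + 1) (?m + 1) (\<lambda>(i, j). M ((xs @ [u]) ! i) ((xs @ [v]) ! j)) =
          mat (?m + 1) (?m + 1) (\<lambda>(i, j). M
            (if (xs @ [c]) ! i = c then u else (xs @ [c]) ! i)
            (if (xs @ [c]) ! j = c then v else (xs @ [c]) ! j))"
        by (intro eq_matI) (auto simp: nth_append less_Suc_eq)
      then show ?thesis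
        using det_mat_eq_set_det[of "xs @ [c]"
            "\<lambda>i j. M (if i = c then u else i) (if j = c then v else j)"] xs that
        by simp
    qed
    also have "\<dots> = set_det T M * s u v"
      using Schur[of "[u]" 1 "[v]"] det_mat_1[of "\<lambda>(i, j). s ([u] ! i) ([v] ! j)"] by simp
    finally show ?thesis .
  qed
  have "set_det (insert a (insert b T)) M =
      det (mat (?m + 2) (?m + 2) (\<lambda>(i, j). M ((xs @ [a, b]) ! i) ((xs @ [a, b]) ! j)))"
    using det_mat_eq_set_det[of "xs @ [a, b]" M] xs ab by (simp add: insert_commute)
  also have "\<dots> = set_det T M * (s a a * s b b - s a b * s b a)"
    by (subst Schur) (auto simp: det_mat_2)
  finally have 2: "set_det (insert a (insert b T)) M = set_det T M * (s a a * s b b - s a b * s b a)" .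
  show ?thesis
    using border[OF ab(1), of a a] border[OF ab(2), of b b] border[OF ab(1), of a b]
      border[OF ab(1), of b a] ab
    by (simp add: 2 algebra_simps)
qed

section \<open>Avoidance probabilities of a determinantal process\<close>

lemma det_mat_cnj: "det (mat n n (\<lambda>ij. cnj (f ij))) = cnj (det (mat n n f))"
  unfolding det_def'[OF mat_carrier] cnj_sum
  by (auto intro!: sum.cong prod.cong simp: permutes_in_image)

text \<open>
  The kernel of the orthogonal projection onto the complement of the span of
  \<open>z 0, ..., z (p - 1)\<close>, when these vectors are orthonormal.
\<close>

definition complement_kernel :: "nat \<Rightarrow> (nat \<Rightarrow> complex vec) \<Rightarrow> nat \<Rightarrow> nat \<Rightarrow> complex" where
  "complement_kernel p z i j =
     (if i = j then 1 else 0) - site_vec p z i \<bullet>c site_vec p z j"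

lemma site_vec_inner: "site_vec p z i \<bullet>c site_vec p z j = (\<Sum>k<p. z k $ i * cnj (z k $ j))"
  by (simp add: site_vec_def scalar_prod_def lessThan_atLeast0 conjugate_complex_def)

lemma complement_kernel_cnj: "cnj (complement_kernel p z i j) = complement_kernel p z j i"
  by (simp add: complement_kernel_def site_vec_inner mult.commute)

lemma determinantal_process_events:
  assumes "determinantal_process M N p z \<phi>"
  shows "{\<omega> \<in> space M. P (\<phi> \<omega>)} \<in> sets M"
proof -
  let ?C = "count_space {S. S \<subseteq> {..<N} \<and> card S = p}"
  have \<phi>: "\<phi> \<in> measurable M ?C"
    using assms by (simp add: determinantal_process_def)
  have "\<phi> -` {S \<in> space ?C. P S} \<inter> space M \<in> sets M"
    by (rule measurable_sets[OF \<phi>]) auto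
  also have "\<phi> -` {S \<in> space ?C. P S} \<inter> space M = {\<omega> \<in> space M. P (\<phi> \<omega>)}"
    using measurable_space[OF \<phi>] by auto
  finally show ?thesis .
qed

text \<open>
  The complement of a determinantal process is determinantal, with kernel \<open>I - K\<close>. Avoiding \<open>A\<close>
  means choosing \<open>p\<close> sites outside \<open>A\<close>, so by the Cauchy--Binet formula the probability is the
  determinant of the \<open>p \<times> p\<close> Gram matrix of the coordinates outside \<open>A\<close>. By orthonormality this
  Gram matrix is \<open>1 - X Y\<close>, where \<open>X Y\<close> is the Gram matrix of the coordinates in \<open>A\<close>, while \<open>1 - Y X\<close>
  is the restriction of \<open>I - K\<close> to \<open>A\<close>.
\<close>

lemma prob_avoid_eq_set_det:
  assumes orth: "orthonormal_family N p z" and proc: "determinantal_process M N p z \<phi>"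
    and A: "A \<subseteq> {..<N}"
  shows "complex_of_real \<P>(\<omega> in M. A \<subseteq> {..<N} - \<phi> \<omega>) = set_det A (complement_kernel p z)"
proof -
  interpret prob_space M using proc by (simp add: determinantal_process_def)
  let ?\<Omega> = "{..<N} - A"
  let ?F = "{S. S \<subseteq> ?\<Omega> \<and> card S = p}"
  let ?minor = "\<lambda>S. det (mat p p (\<lambda>(k, j). z k $ (sorted_list_of_set S ! j)))"
  have \<phi>: "\<phi> \<omega> \<subseteq> {..<N} \<and> card (\<phi> \<omega>) = p" if "\<omega> \<in> space M" for \<omega>
  proof -
    have "\<phi> \<in> measurable M (count_space {S. S \<subseteq> {..<N} \<and> card S = p})"
      using proc by (simp add: determinantal_process_def)
    from measurable_space[OF this that] show ?thesis by simp
  qed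
  have "\<P>(\<omega> in M. A \<subseteq> {..<N} - \<phi> \<omega>) = (\<Sum>S\<in>?F. \<P>(\<omega> in M. \<phi> \<omega> = S))"
  proof (rule prob_sum)
    show "AE \<omega> in M. (\<forall>S\<in>?F. \<phi> \<omega> = S \<longrightarrow> A \<subseteq> {..<N} - \<phi> \<omega>) \<and>
        (A \<subseteq> {..<N} - \<phi> \<omega> \<longrightarrow> (\<exists>!S\<in>?F. \<phi> \<omega> = S))"
    proof (rule AE_I2)
      fix \<omega> assume "\<omega> \<in> space M"
      then have "\<phi> \<omega> \<in> ?F \<longleftrightarrow> A \<subseteq> {..<N} - \<phi> \<omega>"
        using \<phi>[of \<omega>] A by blast
      then show "(\<forall>S\<in>?F. \<phi> \<omega> = S \<longrightarrow> A \<subseteq> {..<N} - \<phi> \<omega>) \<and>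
        (A \<subseteq> {..<N} - \<phi> \<omega> \<longrightarrow> (\<exists>!S\<in>?F. \<phi> \<omega> = S))"
        by blast
    qed
  qed (auto intro: determinantal_process_events[OF proc])
  also have "\<dots> = (\<Sum>S\<in>?F. (cmod (?minor S))\<^sup>2)"
    using proc by (intro sum.cong) (auto simp: determinantal_process_def)
  \<comment> \<open>the conjugate is put on the first factor because then \<open>Y X\<close> below has the entries
    \<open>\<langle>z\<^sub>i, z\<^sub>j\<rangle>\<close> and not their conjugates\<close>
  finally have "complex_of_real \<P>(\<omega> in M. A \<subseteq> {..<N} - \<phi> \<omega>) =
      (\<Sum>S\<in>?F. cnj (?minor S) * ?minor S)"
    by (simp add: complex_norm_square mult.commute del: of_real_power)
  also have "\<dots> = (\<Sum>S\<in>?F. det (mat p p (\<lambda>(k, j). cnj (z k $ (sorted_list_of_set S ! j)))) *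
      det (mat p p (\<lambda>(j, l). z l $ (sorted_list_of_set S ! j))))"
  proof (intro sum.cong refl arg_cong2[where f = "(*)"])
    fix S
    show "cnj (?minor S) = det (mat p p (\<lambda>(k, j). cnj (z k $ (sorted_list_of_set S ! j))))"
      by (simp add: case_prod_unfold flip: det_mat_cnj)
    have "transpose_mat (mat p p (\<lambda>(k, j). z k $ (sorted_list_of_set S ! j))) =
        mat p p (\<lambda>(j, l). z l $ (sorted_list_of_set S ! j))"
      by (intro eq_matI) auto
    then show "?minor S = det (mat p p (\<lambda>(j, l). z l $ (sorted_list_of_set S ! j)))"
      using det_transpose[OF mat_carrier, of p "\<lambda>(k, j). z k $ (sorted_list_of_set S ! j)"]
      by simp
  qed
  also have "\<dots> = det (mat p p (\<lambda>(k, l). \<Sum>i\<in>?\<Omega>. cnj (z k $ i) * z l $ i))"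
    by (rule Cauchy_Binet[symmetric]) simp
  also have "\<dots> = set_det A (complement_kernel p z)"
  proof -
    obtain xs where xs: "distinct xs" "set xs = A"
      using finite_distinct_list finite_subset[OF A] by blast
    define m where "m = length xs"
    define X where "X = mat p m (\<lambda>(k, j). cnj (z k $ (xs ! j)))"
    define Y where "Y = mat m p (\<lambda>(j, l). z l $ (xs ! j))"
    have XY: "X \<in> carrier_mat p m" "Y \<in> carrier_mat m p"
      by (auto simp: X_def Y_def)
    have "mat p p (\<lambda>(k, l). \<Sum>i\<in>?\<Omega>. cnj (z k $ i) * z l $ i) = 1\<^sub>m p - X * Y"
    proof (rule eq_matI)
      fix k l assume "k < dim_row (1\<^sub>m p - X * Y)" "l < dim_col (1\<^sub>m p - X * Y)"
      then have kl: "k < p" "l < p" using XY by auto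
      have "(\<Sum>i<N. cnj (z k $ i) * z l $ i) = z l \<bullet>c z k"
      proof -
        have "z k \<in> carrier_vec N" using orth kl by (simp add: orthonormal_family_def)
        then show ?thesis
          by (auto simp: scalar_prod_def lessThan_atLeast0 conjugate_complex_def intro!: sum.cong)
      qed
      then have "(\<Sum>i<N. cnj (z k $ i) * z l $ i) = (if k = l then 1 else 0)"
        using orth kl by (auto simp: orthonormal_family_def)
      moreover have "(X * Y) $$ (k, l) = (\<Sum>j<m. cnj (z k $ (xs ! j)) * z l $ (xs ! j))"
        using kl by (auto simp: X_def Y_def scalar_prod_def lessThan_atLeast0 intro!: sum.cong)
      moreover have "\<dots> = (\<Sum>i\<in>A. cnj (z k $ i) * z l $ i)"
        by (rule sum.reindex_bij_betw) (use xs in \<open>auto simp: m_def intro!: bij_betw_nth\<close>)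
      moreover have "(\<Sum>i\<in>?\<Omega>. cnj (z k $ i) * z l $ i) =
          (\<Sum>i<N. cnj (z k $ i) * z l $ i) - (\<Sum>i\<in>A. cnj (z k $ i) * z l $ i)"
        using A by (intro sum_diff) auto
      ultimately show "mat p p (\<lambda>(k, l). \<Sum>i\<in>?\<Omega>. cnj (z k $ i) * z l $ i) $$ (k, l) =
          (1\<^sub>m p - X * Y) $$ (k, l)"
        using kl XY by simp
    qed (use XY in auto)
    also have "det \<dots> = det (1\<^sub>m m - Y * X)"
      by (rule det_one_minus_mult_commute[OF XY])
    also have "1\<^sub>m m - Y * X = mat m m (\<lambda>(i, j). complement_kernel p z (xs ! i) (xs ! j))"
    proof (rule eq_matI)
      fix i j assume "i < dim_row (mat m m (\<lambda>(i, j). complement_kernel p z (xs ! i) (xs ! j)))"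
        "j < dim_col (mat m m (\<lambda>(i, j). complement_kernel p z (xs ! i) (xs ! j)))"
      then have ij: "i < m" "j < m" by auto
      then have "(Y * X) $$ (i, j) = site_vec p z (xs ! i) \<bullet>c site_vec p z (xs ! j)"
        unfolding site_vec_inner
        by (auto simp: X_def Y_def scalar_prod_def lessThan_atLeast0 intro!: sum.cong)
      then show "(1\<^sub>m m - Y * X) $$ (i, j) =
          mat m m (\<lambda>(i, j). complement_kernel p z (xs ! i) (xs ! j)) $$ (i, j)"
        using ij XY xs(1) by (simp add: complement_kernel_def nth_eq_iff_index_eq m_def)
    qed (use XY in auto)
    also have "det \<dots> = set_det A (complement_kernel p z)"
      using det_mat_eq_set_det[OF xs(1)] by (simp add: m_def xs)
    finally show ?thesis .
  qed
  finally show ?thesis .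
qed

lemma prob_hit_given_avoid:
  assumes proc: "determinantal_process M N p z \<phi>" and a: "a < N"
  shows "\<P>(\<omega> in M. a \<in> \<phi> \<omega> \<bar> B \<subseteq> {..<N} - \<phi> \<omega>) =
    (\<P>(\<omega> in M. B \<subseteq> {..<N} - \<phi> \<omega>) - \<P>(\<omega> in M. insert a B \<subseteq> {..<N} - \<phi> \<omega>)) /
    \<P>(\<omega> in M. B \<subseteq> {..<N} - \<phi> \<omega>)"
proof -
  interpret prob_space M using proc by (simp add: determinantal_process_def)
  have "{\<omega> \<in> space M. a \<in> \<phi> \<omega> \<and> B \<subseteq> {..<N} - \<phi> \<omega>} =
      {\<omega> \<in> space M. B \<subseteq> {..<N} - \<phi> \<omega>} - {\<omega> \<in> space M. insert a B \<subseteq> {..<N} - \<phi> \<omega>}"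
    using a by auto
  then have "\<P>(\<omega> in M. a \<in> \<phi> \<omega> \<and> B \<subseteq> {..<N} - \<phi> \<omega>) =
      \<P>(\<omega> in M. B \<subseteq> {..<N} - \<phi> \<omega>) - \<P>(\<omega> in M. insert a B \<subseteq> {..<N} - \<phi> \<omega>)"
    by (simp only:, intro finite_measure_Diff determinantal_process_events[OF proc]) auto
  then show ?thesis by (simp add: cond_prob_def)
qed

section \<open>Conditioning on one more avoided site\<close>

theorem proposition2:
  fixes M :: "'a measure" and \<phi> :: "'a \<Rightarrow> nat set"
    and N p n :: nat and z :: "nat \<Rightarrow> complex vec" and x :: "nat \<Rightarrow> nat"
  assumes "1 < p" and "p < N"
    and "orthonormal_family N p z"
    and "determinantal_process M N p z \<phi>"
    and "2 \<le> n" and "n \<le> p"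
    and "inj_on x {1..n}" and "x ` {1..n} \<subseteq> {..<N}"
    and "\<P>(\<omega> in M. x ` {2..n} \<subseteq> {..<N} - \<phi> \<omega>) > 0"
  shows
    "(cmod (site_vec p z (x 1) \<bullet>c site_vec p z (x n) +
        (\<Sum>k = 1..n - 2. (- 1) ^ k *
          (\<Sum>I | I \<subseteq> {2..n - 1} \<and> card I = k.
             let w = map (\<lambda>i. site_vec p z (x i)) (sorted_list_of_set I)
             in wedge_inner (site_vec p z (x 1) # w) (site_vec p z (x n) # w)))))\<^sup>2 =
     \<P>(\<omega> in M. x ` {2..n} \<subseteq> {..<N} - \<phi> \<omega>) *
     \<P>(\<omega> in M. x ` {2..n - 1} \<subseteq> {..<N} - \<phi> \<omega>) *
     (\<P>(\<omega> in M. x 1 \<in> \<phi> \<omega> \<bar> x ` {2..n} \<subseteq> {..<N} - \<phi> \<omega>) -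
      \<P>(\<omega> in M. x 1 \<in> \<phi> \<omega> \<bar> x ` {2..n - 1} \<subseteq> {..<N} - \<phi> \<omega>))"
proof -
  let ?T = "{2..n - 1}"
  let ?s = "\<lambda>i. site_vec p z (x i)"
  let ?avoid = "\<lambda>A. \<P>(\<omega> in M. x ` A \<subseteq> {..<N} - \<phi> \<omega>)"
  interpret prob_space M using assms(4) by (simp add: determinantal_process_def)
  have sets: "{2..n} = insert n ?T" "{1..n - 1} = insert 1 ?T" "{1..n} = insert 1 (insert n ?T)"
    using \<open>2 \<le> n\<close> by auto
  define L where "L i j = complement_kernel p z (x i) (x j)" for i j
  \<comment> \<open>column \<open>1\<close> of the Gram array is replaced by column \<open>n\<close>: its principal minors containing
    index \<open>1\<close> are the inner products of wedge products in the claim\<close>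
  define K where "K i j = ?s i \<bullet>c ?s (if j = 1 then n else j)" for i j
  \<comment> \<open>the minor of \<open>L\<close> on rows \<open>1, 2, ..., n - 1\<close> and columns \<open>n, 2, ..., n - 1\<close>\<close>
  define D where "D = set_det {1..n - 1} (\<lambda>i j. L i (if j = 1 then n else j))"
  have avoid: "complex_of_real (?avoid A) = set_det A L" if "A \<subseteq> {1..n}" for A
  proof -
    have "bij_betw x A (x ` A)"
      using inj_on_subset[OF assms(7) that] by (rule inj_on_imp_bij_betw)
    then have "set_det (x ` A) (complement_kernel p z) = set_det A L"
      unfolding L_def by (rule set_det_reindex) (use that finite_subset in blast)
    moreover have "x ` A \<subseteq> {..<N}" using assms(8) that by blast
    ultimately show ?thesis using prob_avoid_eq_set_det[OF assms(3,4)] by simp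
  qed
  have "x ` ?T \<subseteq> x ` {2..n}" by (rule image_mono) auto
  then have "?avoid {2..n} \<le> ?avoid ?T"
    by (intro finite_measure_mono determinantal_process_events[OF assms(4)]) blast
  then have pos: "?avoid ?T > 0" "?avoid {2..n} > 0" using assms(9) by auto

  have wedge: "wedge_inner (?s 1 # w) (?s n # w) = set_det (insert 1 I) K"
    if "I \<subseteq> ?T" and w: "w = map ?s (sorted_list_of_set I)" for I w
  proof -
    let ?l = "1 # sorted_list_of_set I"
    have I: "finite I" "1 \<notin> I" using that finite_subset by auto
    then have "(sorted_list_of_set I) ! i \<noteq> 1" if "i < card I" for i
      using that nth_mem[of i "sorted_list_of_set I"] by auto
    then have "mat (length (?s 1 # w)) (length (?s 1 # w))
        (\<lambda>(i, j). (?s 1 # w) ! i \<bullet>c (?s n # w) ! j) =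
      mat (length ?l) (length ?l) (\<lambda>(i, j). K (?l ! i) (?l ! j))"
      by (intro eq_matI) (auto simp: w K_def nth_Cons split: nat.split)
    then show ?thesis
      unfolding wedge_inner_def using det_mat_eq_set_det[of ?l K] I by simp
  qed
  let ?f = "\<lambda>k. (- 1) ^ k * (\<Sum>I | I \<subseteq> ?T \<and> card I = k. set_det (insert 1 I) K)"
  have "L i (if j = 1 then n else j) = (if i = j \<and> i \<noteq> 1 then 1 else 0) - K i j"
    if "i \<in> insert 1 ?T" "j \<in> insert 1 ?T" for i j
  proof -
    have "i \<in> {1..n}" "j \<in> {1..n}" "n \<in> {1..n}" "i \<noteq> n"
      using that \<open>2 \<le> n\<close> by auto
    then have "x i = x j \<longleftrightarrow> i = j" "x i \<noteq> x n"
      using inj_on_eq_iff[OF assms(7)] by auto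
    then show ?thesis by (simp add: L_def K_def complement_kernel_def)
  qed
  then have "D = set_det (insert 1 ?T) (\<lambda>i j. (if i = j \<and> i \<noteq> 1 then 1 else 0) - K i j)"
    unfolding D_def sets by (intro set_det_cong) auto
  also have "\<dots> = - (\<Sum>k\<le>card ?T. ?f k)"
    by (rule set_det_bordered_one_minus) auto
  \<comment> \<open>the term \<open>k = 0\<close> of the expansion is the inner product standing before the sum in the claim\<close>
  also have "{..card ?T} = insert 0 {1..n - 2}"
    by auto
  also have "sum ?f (insert 0 {1..n - 2}) = K 1 1 + sum ?f {1..n - 2}"
  proof -
    have "{I. I \<subseteq> ?T \<and> card I = 0} = {{}}"
      using finite_subset[of _ ?T] by auto
    then show ?thesis by (simp add: set_det_def)
  qed
  finally have D: "K 1 1 + sum ?f {1..n - 2} = - D" by simp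
  have "?s 1 \<bullet>c ?s n + (\<Sum>k = 1..n - 2. (- 1) ^ k * (\<Sum>I | I \<subseteq> ?T \<and> card I = k.
      let w = map ?s (sorted_list_of_set I) in wedge_inner (?s 1 # w) (?s n # w))) =
      K 1 1 + sum ?f {1..n - 2}"
    by (intro arg_cong2[where f = "(+)"] sum.cong refl arg_cong2[where f = "(*)"])
       (auto simp: K_def Let_def wedge[OF _ refl, simplified])
  then have bracket: "?s 1 \<bullet>c ?s n + (\<Sum>k = 1..n - 2. (- 1) ^ k * (\<Sum>I | I \<subseteq> ?T \<and> card I = k.
      let w = map ?s (sorted_list_of_set I) in wedge_inner (?s 1 # w) (?s n # w))) = - D"
    using D by simp

  \<comment> \<open>the kernel is Hermitian, so the two mixed minors in the identity are conjugate\<close>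
  have cnj: "set_det {1..n - 1} (\<lambda>i j. L (if i = 1 then n else i) j) = cnj D"
  proof -
    have "cnj D = set_det {1..n - 1} (\<lambda>i j. cnj (L i (if j = 1 then n else j)))"
      unfolding D_def by (rule set_det_cnj[symmetric])
    also have "\<dots> = set_det {1..n - 1} (\<lambda>i j. L (if j = 1 then n else j) i)"
      by (simp only: L_def complement_kernel_cnj)
    also have "\<dots> = set_det {1..n - 1} (\<lambda>i j. L (if i = 1 then n else i) j)"
      by (rule set_det_transpose) simp
    finally show ?thesis ..
  qed
  have "set_det (insert 1 ?T) L * set_det (insert n ?T) L -
      set_det ?T L * set_det (insert 1 (insert n ?T)) L = D * cnj D"
    unfolding cnj[symmetric] unfolding D_def sets
  proof (rule Desnanot_Jacobi)
    have "complex_of_real (?avoid ?T) = set_det ?T L" by (rule avoid) auto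
    with pos show "set_det ?T L \<noteq> 0" by auto
  qed (use \<open>2 \<le> n\<close> in auto)
  then have "set_det {1..n - 1} L * set_det {2..n} L - set_det ?T L * set_det {1..n} L = D * cnj D"
    unfolding sets .
  then have "complex_of_real (?avoid {1..n - 1} * ?avoid {2..n} - ?avoid ?T * ?avoid {1..n}) =
      D * cnj D"
    by (simp add: avoid)
  then have DJ: "?avoid {1..n - 1} * ?avoid {2..n} - ?avoid ?T * ?avoid {1..n} = (cmod D)\<^sup>2"
    unfolding complex_norm_square[symmetric] of_real_eq_iff .

  have "1 \<in> {1..n}" using \<open>2 \<le> n\<close> by simp
  then have x1: "x 1 < N" using assms(8) by blast
  have hit: "\<P>(\<omega> in M. x 1 \<in> \<phi> \<omega> \<bar> x ` A \<subseteq> {..<N} - \<phi> \<omega>) =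
      (?avoid A - ?avoid (insert 1 A)) / ?avoid A" for A
    using prob_hit_given_avoid[OF assms(4) x1, of "x ` A"] by simp
  have ins: "insert 1 {2..n} = {1..n}" "insert 1 ?T = {1..n - 1}"
    using \<open>2 \<le> n\<close> by auto
  show ?thesis
    unfolding bracket hit ins norm_minus_cancel DJ[symmetric]
    using pos by (simp add: field_simps)
qed

end
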